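(* Let $\mathcal{H}$ be a Hilbert space and let $T\in L(\mathcal{H})$ be a product of two orthogonal projections. If $T=P_{\mathcal{M}}P_{\mathcal{N}}$ for closed subspaces $\mathcal{M},\mathcal{N}$ of $\mathcal{H}$, then $$\|(P_{\mathcal{M}}-P_{\mathcal{N}})x\|\ge\|(P_{\overline{R(T)}}-P_{N(T)^\perp})x\|\quad\text{for all }x\in\mathcal{H},$$ that is, $(P_{\mathcal{M}}-P_{\mathcal{N}})^2\ge(P_{\overline{R(T)}}-P_{N(T)^\perp})^2$.
   Context: $L(\mathcal{H})$ is the algebra of bounded linear operators on $\mathcal{H}$; $R(T)$ and $N(T)$ denote range and nullspace. $P_{\mathcal{M}}$ is the orthogonal projection onto the closed subspace $\mathcal{M}$. The order $\ge$ is the usual order on bounded self-adjoint operators. *)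

theory Defs
  imports "HOL-Analysis.Analysis"
begin

text \<open>
  Hilbert spaces are treated over the reals and over the complex numbers at the same time.
  The fields of the following class are, up to isomorphism, exactly these two: every \<open>z\<close> is a root
  of the real polynomial \<open>X\<^sup>2 - (z + scnj z) X + z * scnj z\<close>, so the field is algebraic
  over the reals.
\<close>

class real_or_complex = real_normed_field +
  fixes scnj :: "'a \<Rightarrow> 'a"
  assumes scnj_add: "scnj (a + b) = scnj a + scnj b"
    and scnj_mult: "scnj (a * b) = scnj a * scnj b"
    and scnj_scnj: "scnj (scnj a) = a"
    and add_scnj: "\<exists>r. a + scnj a = r *\<^sub>R 1"
    and mult_scnj: "a * scnj a = (norm a)\<^sup>2 *\<^sub>R 1"

instantiation real :: real_or_complex
begin
definition scnj_real :: "real \<Rightarrow> real" where "scnj_real a = a"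
instance by standard (auto simp: scnj_real_def power2_eq_square)
end

instantiation complex :: real_or_complex
begin
definition scnj_complex :: "complex \<Rightarrow> complex" where "scnj_complex = cnj"
instance
proof
  fix a b :: complex
  show "\<exists>r. a + scnj a = r *\<^sub>R 1"
    by (rule exI [of _ "2 * Re a"]) (simp add: scnj_complex_def complex_eq_iff)
  show "a * scnj a = (norm a)\<^sup>2 *\<^sub>R 1"
    by (simp add: scnj_complex_def complex_eq_iff cmod_power2 [unfolded power2_eq_square] power2_eq_square)
qed (simp_all add: scnj_complex_def)
end

text \<open>
  Completeness of the space is the sort \<open>banach\<close> of its type; the last axiom says that the norm is
  the one induced by the inner product, which is linear in the first argument.
\<close>

locale hilbert_space = vector_space smul
  for smul :: "'k::real_or_complex \<Rightarrow> 'h::banach \<Rightarrow> 'h" +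
  fixes ip :: "'h \<Rightarrow> 'h \<Rightarrow> 'k"
  assumes scale_of_real: "smul (of_real r) x = r *\<^sub>R x"
    and ip_add_left: "ip (x + y) z = ip x z + ip y z"
    and ip_scale_left: "ip (smul a x) y = a * ip x y"
    and ip_commute: "ip y x = scnj (ip x y)"
    and ip_self: "ip x x = of_real ((norm x)\<^sup>2)"

lemma hilbert_space_real:
  "hilbert_space scaleR (inner :: 'a::{real_inner,banach} \<Rightarrow> 'a \<Rightarrow> real)"
  by unfold_locales
     (auto simp: algebra_simps inner_commute scnj_real_def power2_norm_eq_inner)

lemma hilbert_space_complex:
  "hilbert_space (*) (\<lambda>x y :: complex. x * cnj y)"
  by unfold_locales
     (simp_all add: complex_eq_iff scnj_complex_def cmod_power2 [unfolded power2_eq_square] power2_eq_square algebra_simps)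

definition closed_subspace ::
    "('k::field \<Rightarrow> 'h \<Rightarrow> 'h) \<Rightarrow> 'h::{ab_group_add,topological_space} set \<Rightarrow> bool"
  where "closed_subspace smul M \<longleftrightarrow> module.subspace smul M \<and> closed M"

definition bounded_ops ::
    "('k::field \<Rightarrow> 'h \<Rightarrow> 'h) \<Rightarrow> ('h::real_normed_vector \<Rightarrow> 'h) set"
  where "bounded_ops smul =
    {T. Vector_Spaces.linear smul smul T \<and> (\<exists>K. \<forall>x. norm (T x) \<le> K * norm x)}"

definition orth_compl :: "('h \<Rightarrow> 'h \<Rightarrow> 'k::zero) \<Rightarrow> 'h set \<Rightarrow> 'h set"
  where "orth_compl ip M = {x. \<forall>y\<in>M. ip x y = 0}"

text \<open>Meaningful only for a closed subspace \<open>M\<close> of a Hilbert space.\<close>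

definition orth_proj :: "('h \<Rightarrow> 'h \<Rightarrow> 'k::zero) \<Rightarrow> 'h::minus set \<Rightarrow> 'h \<Rightarrow> 'h"
  where "orth_proj ip M x = (THE y. y \<in> M \<and> x - y \<in> orth_compl ip M)"

definition null_space :: "('h \<Rightarrow> 'h::zero) \<Rightarrow> 'h set"
  where "null_space T = {x. T x = 0}"

definition self_adjoint :: "('h \<Rightarrow> 'h \<Rightarrow> 'k) \<Rightarrow> ('h \<Rightarrow> 'h) \<Rightarrow> bool"
  where "self_adjoint ip A \<longleftrightarrow> (\<forall>x y. ip (A x) y = ip x (A y))"

definition op_ge ::
    "('k::real_or_complex \<Rightarrow> 'h \<Rightarrow> 'h) \<Rightarrow> ('h \<Rightarrow> 'h \<Rightarrow> 'k) \<Rightarrow>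
     ('h::real_normed_vector \<Rightarrow> 'h) \<Rightarrow> ('h \<Rightarrow> 'h) \<Rightarrow> bool"
  where "op_ge smul ip A B \<longleftrightarrow>
    A \<in> bounded_ops smul \<and> self_adjoint ip A \<and>
    B \<in> bounded_ops smul \<and> self_adjoint ip B \<and>
    (\<forall>x. ip (A x - B x) x \<in> \<real>\<^sub>\<ge>\<^sub>0)"

end

theory Submission imports Defs begin

text \<open>
  Write \<open>M\<^sub>0\<close> for the closure of \<open>R(T)\<close> and \<open>N\<^sub>0\<close> for \<open>N(T)\<^sup>\<bottom>\<close>. Then
  \<open>M\<^sub>0 \<subseteq> M\<close> with \<open>M \<ominus> M\<^sub>0 = M \<inter> N\<^sup>\<bottom>\<close>, and \<open>N\<^sub>0 \<subseteq> N\<close> with \<open>N \<ominus> N\<^sub>0 = N \<inter> M\<^sup>\<bottom>\<close>.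
  Hence \<open>(P\<^sub>M - P\<^sub>N) x\<close> is the sum of \<open>(P\<^bsub>M\<^sub>0\<^esub> - P\<^bsub>N\<^sub>0\<^esub>) x\<close> and the difference \<open>u - v\<close> of some
  \<open>u \<in> M \<inter> N\<^sup>\<bottom>\<close> and \<open>v \<in> N \<inter> M\<^sup>\<bottom>\<close>. Both \<open>u\<close> and \<open>v\<close> are orthogonal to \<open>M\<^sub>0\<close> and to \<open>N\<^sub>0\<close>,
  so the norm inequality is Pythagoras' theorem. The operator inequality follows because
  \<open>P\<^sub>M - P\<^sub>N\<close> and \<open>P\<^bsub>M\<^sub>0\<^esub> - P\<^bsub>N\<^sub>0\<^esub>\<close> are self-adjoint.
\<close>

context hilbert_space
begin

section \<open>Algebra of the inner product and norm identities\<close>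

lemma scnj_zero [simp]: "scnj (0::'k) = 0"
  using scnj_add [of "0::'k" 0] by simp

lemma ip_zero_left [simp]: "ip 0 y = 0"
  using ip_add_left [of 0 0 y] by simp

lemma ip_zero_right [simp]: "ip y 0 = 0"
  by (metis ip_commute ip_zero_left scnj_zero)

lemma ip_add_right: "ip x (y + z) = ip x y + ip x z"
  by (metis ip_commute ip_add_left scnj_add)

lemma ip_diff_left: "ip (x - y) z = ip x z - ip y z"
  using ip_add_left [of "x - y" y z] by (simp add: algebra_simps)

lemma ip_diff_right: "ip x (y - z) = ip x y - ip x z"
  using ip_add_right [of x "y - z" z] by (simp add: algebra_simps)

lemma ip_scale_right: "ip x (smul a y) = scnj a * ip x y"
  by (metis ip_commute ip_scale_left scnj_mult)

lemma ip_eq_zero_commute: "ip x y = 0 \<longleftrightarrow> ip y x = 0"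
  by (metis ip_commute scnj_zero)

lemma ip_self_eq_zero [simp]: "ip x x = 0 \<longleftrightarrow> x = 0"
  by (simp add: ip_self)

text \<open>Squared norms become inner products only after embedding them into the scalar field, so
  the computation takes place there and returns through injectivity of
  \<open>of_real\<close>.\<close>

lemma norm_add_pythagoras:
  assumes "ip x y = 0"
  shows "(norm (x + y))\<^sup>2 = (norm x)\<^sup>2 + (norm y)\<^sup>2"
proof -
  have "ip y x = 0"
    using assms ip_eq_zero_commute by blast
  then have "of_real ((norm (x + y))\<^sup>2) = (of_real ((norm x)\<^sup>2 + (norm y)\<^sup>2) :: 'k)"
    using assms by (simp add: ip_self [symmetric] ip_add_left ip_add_right del: of_real_power)
  then show ?thesis
    by (simp only: of_real_eq_iff)
qed

lemma parallelogram_law: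
  fixes x y :: 'h
  shows "(norm (x + y))\<^sup>2 + (norm (x - y))\<^sup>2 = 2 * (norm x)\<^sup>2 + 2 * (norm y)\<^sup>2"
proof -
  \<comment> \<open>The doubled squares are written as sums, so that \<open>ip_self\<close> read
    backwards turns every term into an inner product.\<close>
  have "of_real ((norm (x + y))\<^sup>2 + (norm (x - y))\<^sup>2)
      = (of_real ((norm x)\<^sup>2 + (norm x)\<^sup>2 + ((norm y)\<^sup>2 + (norm y)\<^sup>2)) :: 'k)"
    by (simp add: ip_self [symmetric] ip_add_left ip_add_right ip_diff_left ip_diff_right
        del: of_real_power)
  then have "(norm (x + y))\<^sup>2 + (norm (x - y))\<^sup>2
      = (norm x)\<^sup>2 + (norm x)\<^sup>2 + ((norm y)\<^sup>2 + (norm y)\<^sup>2)"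
    by (simp only: of_real_eq_iff)
  then show ?thesis
    by simp
qed

lemma norm_smul: "norm (smul a x) = norm a * norm x"
proof -
  have "of_real ((norm (smul a x))\<^sup>2) = a * scnj a * of_real ((norm x)\<^sup>2)"
    by (simp only: ip_self [symmetric] ip_scale_left ip_scale_right mult_ac)
  also have "\<dots> = (of_real ((norm a * norm x)\<^sup>2) :: 'k)"
    by (simp add: mult_scnj power_mult_distrib scaleR_conv_of_real)
  finally show ?thesis
    by (simp only: of_real_eq_iff) simp
qed

section \<open>Continuity of scaling, closures of subspaces and nearest points\<close>

lemma bounded_linear_smul: "bounded_linear (smul a)"
proof
  show "smul a (x + y) = smul a x + smul a y" for x y
    by (rule scale_right_distrib)
  show "smul a (r *\<^sub>R x) = r *\<^sub>R smul a x" for r x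
    by (simp add: scale_of_real [symmetric] mult.commute)
  show "\<exists>K. \<forall>x. norm (smul a x) \<le> norm x * K"
    by (rule exI [of _ "norm a"]) (simp add: norm_smul mult.commute)
qed

lemma subspace_closure:
  assumes "subspace S"
  shows "subspace (closure S)"
proof (rule subspaceI)
  show "0 \<in> closure S"
    using assms subspace_0 closure_subset by blast
next
  fix x y assume "x \<in> closure S" "y \<in> closure S"
  then obtain f g where "\<forall>n. f n \<in> S" "f \<longlonglongrightarrow> x" "\<forall>n. g n \<in> S" "g \<longlonglongrightarrow> y"
    unfolding closure_sequential by blast
  then show "x + y \<in> closure S"
    unfolding closure_sequential using assms
    by (intro exI [of _ "\<lambda>n. f n + g n"]) (auto intro: tendsto_add subspace_add)
next
  fix a x assume "x \<in> closure S"
  then obtain f where "\<forall>n. f n \<in> S" "f \<longlonglongrightarrow> x"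
    unfolding closure_sequential by blast
  then show "smul a x \<in> closure S"
    unfolding closure_sequential using assms
    by (intro exI [of _ "\<lambda>n. smul a (f n)"])
       (auto intro: bounded_linear.tendsto [OF bounded_linear_smul] subspace_scale)
qed

text \<open>A minimising sequence in \<open>M\<close> is Cauchy by the parallelogram law, because
  midpoints stay in \<open>M\<close>. Completeness gives a limit, and closedness keeps it in
  \<open>M\<close>.\<close>

lemma closest_point_exists:
  assumes "closed_subspace smul M"
  shows "\<exists>p\<in>M. \<forall>m\<in>M. norm (x - p) \<le> norm (x - m)"
proof -
  have sub: "subspace M" and clo: "closed M"
    using assms by (auto simp: closed_subspace_def)
  define d where "d = (INF m\<in>M. (norm (x - m))\<^sup>2)"
  have ne: "M \<noteq> {}"
    using subspace_0 [OF sub] by blast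
  have bdd: "bdd_below ((\<lambda>m. (norm (x - m))\<^sup>2) ` M)"
    by (rule bdd_belowI2 [of _ 0]) simp
  have d_le: "d \<le> (norm (x - m))\<^sup>2" if "m \<in> M" for m
    unfolding d_def by (rule cINF_lower [OF bdd that])
  have "\<exists>m\<in>M. (norm (x - m))\<^sup>2 < d + 1 / Suc n" for n
    using cINF_less_iff [OF ne bdd, of "d + 1 / Suc n"] by (simp add: d_def)
  then obtain f where fM: "\<And>n. f n \<in> M" and f_less: "\<And>n. (norm (x - f n))\<^sup>2 < d + 1 / Suc n"
    by metis
  have f_dist: "(norm (f m - f n))\<^sup>2 \<le> 2 / Suc m + 2 / Suc n" for m n
  proof -
    have mid: "smul (of_real (1/2)) (f m + f n) \<in> M"
      using sub fM by (intro subspace_scale subspace_add)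
    have "(x - f m) + (x - f n) = 2 *\<^sub>R (x - (1/2) *\<^sub>R (f m + f n))"
      by (simp add: algebra_simps scaleR_2)
    then have "(norm ((x - f m) + (x - f n)))\<^sup>2 = 4 * (norm (x - (1/2) *\<^sub>R (f m + f n)))\<^sup>2"
      by (simp add: power_mult_distrib)
    moreover have "d \<le> (norm (x - (1/2) *\<^sub>R (f m + f n)))\<^sup>2"
      using d_le [OF mid] by (simp only: scale_of_real)
    ultimately have "4 * d \<le> (norm ((x - f m) + (x - f n)))\<^sup>2"
      by simp
    moreover have "(norm ((x - f m) - (x - f n)))\<^sup>2 = (norm (f m - f n))\<^sup>2"
      by (simp add: norm_minus_commute)
    ultimately show ?thesis
      using parallelogram_law [of "x - f m" "x - f n"] f_less [of m] f_less [of n]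
      by linarith
  qed
  have "Cauchy f"
  proof (rule metric_CauchyI)
    fix e :: real assume "0 < e"
    \<comment> \<open>Beyond index \<open>K\<close> the bound \<open>f_dist\<close> is at most
      \<open>4 / Suc K\<close>, hence the quarter.\<close>
    then have "0 < e\<^sup>2 / 4"
      by simp
    then obtain K where K: "1 / Suc K < e\<^sup>2 / 4"
      using nat_approx_posE by blast
    have "dist (f m) (f n) < e" if "m \<ge> K" "n \<ge> K" for m n
    proof -
      have "2 / Suc m \<le> 2 / Suc K" "2 / Suc n \<le> 2 / Suc K"
        using that by (auto intro!: divide_left_mono)
      then have "(norm (f m - f n))\<^sup>2 < e\<^sup>2"
        using f_dist [of m n] K by simp
      then show ?thesis
        using \<open>0 < e\<close> by (simp add: dist_norm power_less_imp_less_base)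
    qed
    then show "\<exists>K. \<forall>m\<ge>K. \<forall>n\<ge>K. dist (f m) (f n) < e"
      by blast
  qed
  then obtain p where p: "f \<longlonglongrightarrow> p"
    using Cauchy_convergent convergent_def by blast
  have "p \<in> M"
    using closed_sequentially [OF clo] fM p by blast
  moreover have "(norm (x - p))\<^sup>2 \<le> d"
  proof (rule LIMSEQ_le)
    show "(\<lambda>n. (norm (x - f n))\<^sup>2) \<longlonglongrightarrow> (norm (x - p))\<^sup>2"
      by (intro tendsto_intros p)
    show "(\<lambda>n. d + 1 / Suc n) \<longlonglongrightarrow> d"
      using tendsto_add [OF tendsto_const [of d] LIMSEQ_inverse_real_of_nat]
      by (simp add: inverse_eq_divide)
    show "\<exists>N. \<forall>n\<ge>N. (norm (x - f n))\<^sup>2 \<le> d + 1 / Suc n"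
      using f_less less_imp_le by blast
  qed
  ultimately show ?thesis
    using d_le by (meson order_trans power2_le_imp_le norm_ge_zero)
qed

section \<open>Existence and uniqueness of orthogonal projections\<close>

lemma orth_proj_exists:
  assumes "closed_subspace smul M"
  shows "\<exists>p\<in>M. x - p \<in> orth_compl ip M"
proof -
  have sub: "subspace M"
    using assms by (auto simp: closed_subspace_def)
  obtain p where p: "p \<in> M" "\<And>m. m \<in> M \<Longrightarrow> norm (x - p) \<le> norm (x - m)"
    using closest_point_exists [OF assms] by blast
  have "ip (x - p) y = 0" if "y \<in> M" for y
  proof (cases "y = 0")
    case False
    \<comment> \<open>\<open>smul a y\<close> is the component of \<open>x - p\<close> along
      \<open>y\<close>, and \<open>w\<close> is the rest. Since \<open>p + smul a y\<close> competes
      with \<open>p\<close> in \<open>M\<close>, minimality forces this component to vanish.\<close>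
    define a where "a = ip (x - p) y / ip y y"
    define w where "w = x - p - smul a y"
    have "ip w y = 0"
      using False by (simp add: w_def a_def ip_diff_left [of "x - p"] ip_scale_left)
    then have "(norm (w + smul a y))\<^sup>2 = (norm w)\<^sup>2 + (norm (smul a y))\<^sup>2"
      by (intro norm_add_pythagoras) (simp add: ip_scale_right)
    moreover have "norm (x - p) \<le> norm w"
      using p(2) [of "p + smul a y"] sub p(1) that
      by (simp add: w_def diff_diff_eq subspace_add subspace_scale)
    moreover have w: "x - p = w + smul a y"
      by (simp add: w_def)
    ultimately have "(norm (smul a y))\<^sup>2 \<le> 0"
      by (smt (verit) norm_ge_zero power_mono)
    then have "smul a y = 0"
      by simp
    then show ?thesis
      using \<open>ip w y = 0\<close> w by (simp only: add_0_right)
  qed simp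
  then show ?thesis
    using p(1) by (auto simp: orth_compl_def)
qed

lemma orth_proj_unique:
  assumes "subspace M" "p \<in> M" "x - p \<in> orth_compl ip M" "q \<in> M" "x - q \<in> orth_compl ip M"
  shows "q = p"
proof -
  have "q - p \<in> M"
    using assms by (simp add: subspace_diff)
  then have "ip (x - p) (q - p) = 0" "ip (x - q) (q - p) = 0"
    using assms by (auto simp: orth_compl_def)
  then have "ip (q - p) (q - p) = 0"
    by (simp add: ip_diff_left)
  then show ?thesis
    by simp
qed

lemma orth_proj_eqI:
  assumes "subspace M" "p \<in> M" "x - p \<in> orth_compl ip M"
  shows "orth_proj ip M x = p"
  unfolding orth_proj_def
proof (rule the_equality)
  show "p \<in> M \<and> x - p \<in> orth_compl ip M"
    using assms(2,3) ..
  show "q = p" if "q \<in> M \<and> x - q \<in> orth_compl ip M" for q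
    using orth_proj_unique [OF assms] that by blast
qed

lemma
  assumes "closed_subspace smul M"
  shows orth_proj_in: "orth_proj ip M x \<in> M"
    and orth_proj_diff: "x - orth_proj ip M x \<in> orth_compl ip M"
proof -
  obtain p where "p \<in> M" "x - p \<in> orth_compl ip M"
    using orth_proj_exists [OF assms] by blast
  moreover from this have "orth_proj ip M x = p"
    using assms orth_proj_eqI by (auto simp: closed_subspace_def)
  ultimately show "orth_proj ip M x \<in> M" "x - orth_proj ip M x \<in> orth_compl ip M"
    by auto
qed

lemma subspace_orth_compl: "subspace (orth_compl ip S)"
  by (rule subspaceI) (auto simp: orth_compl_def ip_add_left ip_scale_left)

lemma ip_orth_compl:
  assumes "x \<in> orth_compl ip S" "y \<in> S"
  shows "ip x y = 0" "ip y x = 0"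
  using assms ip_eq_zero_commute by (auto simp: orth_compl_def)

text \<open>The candidate qualifies because \<open>S\<close> lies in its double complement. This
  reduces the projection onto the complement of \<open>null_space T\<close> to the one onto
  \<open>null_space T\<close> itself.\<close>

lemma orth_proj_orth_compl:
  assumes "closed_subspace smul S"
  shows "orth_proj ip (orth_compl ip S) x = x - orth_proj ip S x"
proof (rule orth_proj_eqI [OF subspace_orth_compl orth_proj_diff [OF assms]])
  show "x - (x - orth_proj ip S x) \<in> orth_compl ip (orth_compl ip S)"
    using orth_proj_in [OF assms] ip_orth_compl(2) by (auto simp: orth_compl_def [of _ "orth_compl ip S"])
qed

section \<open>Bounded operators, their ranges and null spaces\<close>

lemma bounded_opsI:
  assumes "\<And>x y. A (x + y) = A x + A y" "\<And>a x. A (smul a x) = smul a (A x)"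
    and "\<And>x. norm (A x) \<le> K * norm x"
  shows "A \<in> bounded_ops smul"
proof -
  have "Vector_Spaces.linear smul smul A"
    by unfold_locales (fact assms(1,2))+
  then show ?thesis
    unfolding bounded_ops_def using assms(3) by blast
qed

lemma bounded_ops_linear:
  assumes "A \<in> bounded_ops smul"
  shows "A (x + y) = A x + A y" "A (smul a x) = smul a (A x)"
proof -
  interpret A: Vector_Spaces.linear smul smul A
    using assms by (simp add: bounded_ops_def)
  show "A (x + y) = A x + A y" "A (smul a x) = smul a (A x)"
    by (rule A.add A.scale)+
qed

lemma bounded_ops_zero:
  assumes "A \<in> bounded_ops smul"
  shows "A 0 = 0"
  using bounded_ops_linear(1) [OF assms, of 0 0] by simp

text \<open>The constant in \<open>bounded_ops\<close> carries no sign; its absolute value also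
  works and can be multiplied into inequalities, as composition requires.\<close>

lemma bounded_ops_bound:
  assumes "A \<in> bounded_ops smul"
  obtains K where "0 \<le> K" "\<And>x. norm (A x) \<le> K * norm x"
proof -
  obtain K where K: "\<And>x. norm (A x) \<le> K * norm x"
    using assms by (auto simp: bounded_ops_def)
  have "norm (A x) \<le> \<bar>K\<bar> * norm x" for x
    using K [of x] by (meson abs_ge_self mult_right_mono norm_ge_zero order_trans)
  then show ?thesis
    using that [of "\<bar>K\<bar>"] by simp
qed

lemma bounded_ops_bounded_linear:
  assumes "A \<in> bounded_ops smul"
  shows "bounded_linear A"
proof
  show "A (x + y) = A x + A y" "A (r *\<^sub>R x) = r *\<^sub>R A x" for x y r
    using bounded_ops_linear [OF assms] by (simp_all add: scale_of_real [symmetric])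
  show "\<exists>K. \<forall>x. norm (A x) \<le> norm x * K"
    using assms by (auto simp: bounded_ops_def mult.commute)
qed

lemma bounded_ops_diff:
  assumes A: "A \<in> bounded_ops smul" and B: "B \<in> bounded_ops smul"
  shows "(\<lambda>x. A x - B x) \<in> bounded_ops smul"
proof -
  obtain K L where "\<And>x. norm (A x) \<le> K * norm x" "\<And>x. norm (B x) \<le> L * norm x"
    using bounded_ops_bound assms by metis
  then have "norm (A x - B x) \<le> (K + L) * norm x" for x
    by (smt (verit) distrib_right norm_triangle_ineq4)
  then show ?thesis
    by (intro bounded_opsI)
       (auto simp: bounded_ops_linear [OF A] bounded_ops_linear [OF B] scale_right_diff_distrib)
qed

lemma bounded_ops_comp:
  assumes A: "A \<in> bounded_ops smul" and B: "B \<in> bounded_ops smul"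
  shows "A \<circ> B \<in> bounded_ops smul"
proof -
  obtain K L where KL: "0 \<le> K" "\<And>x. norm (A x) \<le> K * norm x" "\<And>x. norm (B x) \<le> L * norm x"
    using bounded_ops_bound assms by metis
  have "norm ((A \<circ> B) x) \<le> (K * L) * norm x" for x
  proof -
    have "norm ((A \<circ> B) x) \<le> K * norm (B x)"
      using KL(2) by simp
    also have "\<dots> \<le> K * (L * norm x)"
      using KL by (intro mult_left_mono) auto
    finally show ?thesis
      by (simp add: mult.assoc)
  qed
  then show ?thesis
    by (intro bounded_opsI) (auto simp: bounded_ops_linear [OF A] bounded_ops_linear [OF B])
qed

lemma closed_subspace_closure_range:
  assumes "A \<in> bounded_ops smul"
  shows "closed_subspace smul (closure (range A))"
proof -
  have "subspace (range A)"
  proof (rule subspaceI)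
    show "0 \<in> range A"
      using bounded_ops_zero [OF assms] by (metis rangeI)
  qed (auto simp: bounded_ops_linear [OF assms, symmetric])
  then show ?thesis
    by (simp add: closed_subspace_def subspace_closure)
qed

lemma closed_subspace_null_space:
  assumes "A \<in> bounded_ops smul"
  shows "closed_subspace smul (null_space A)"
proof -
  have "subspace (null_space A)"
    using bounded_ops_linear [OF assms] bounded_ops_zero [OF assms]
    by (intro subspaceI) (auto simp: null_space_def)
  moreover have "closed (null_space A)"
    unfolding null_space_def
    by (intro closed_Collect_eq continuous_intros
        linear_continuous_on [OF bounded_ops_bounded_linear [OF assms]])
  ultimately show ?thesis
    by (simp add: closed_subspace_def)
qed

section \<open>Orthogonal projections as operators, and the order on squares\<close>

lemma orth_proj_bounded_ops:
  assumes "closed_subspace smul M"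
  shows "orth_proj ip M \<in> bounded_ops smul"
proof (rule bounded_opsI)
  let ?P = "orth_proj ip M"
  have sub: "subspace M"
    using assms by (auto simp: closed_subspace_def)
  note P = orth_proj_in [OF assms] orth_proj_diff [OF assms]
  show "?P (x + y) = ?P x + ?P y" for x y
  proof (rule orth_proj_eqI [OF sub])
    have "(x - ?P x) + (y - ?P y) \<in> orth_compl ip M"
      by (intro subspace_add [OF subspace_orth_compl] P)
    then show "x + y - (?P x + ?P y) \<in> orth_compl ip M"
      by (simp add: add_diff_add)
  qed (intro subspace_add [OF sub] P)
  show "?P (smul a x) = smul a (?P x)" for a x
  proof (rule orth_proj_eqI [OF sub])
    have "smul a (x - ?P x) \<in> orth_compl ip M"
      by (intro subspace_scale [OF subspace_orth_compl] P)
    then show "smul a x - smul a (?P x) \<in> orth_compl ip M"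
      by (simp add: scale_right_diff_distrib)
  qed (intro subspace_scale [OF sub] P)
  show "norm (?P x) \<le> 1 * norm x" for x
  proof -
    have "(norm (?P x + (x - ?P x)))\<^sup>2 = (norm (?P x))\<^sup>2 + (norm (x - ?P x))\<^sup>2"
      using ip_orth_compl(2) P by (intro norm_add_pythagoras) blast
    then have "(norm (?P x))\<^sup>2 \<le> (norm x)\<^sup>2"
      by simp
    then show ?thesis
      using power2_le_imp_le [OF _ norm_ge_zero] by simp
  qed
qed

text \<open>Both sides equal \<open>ip (?P x) (?P y)\<close>, since the remainders are orthogonal to
  \<open>M\<close>.\<close>

lemma orth_proj_self_adjoint:
  assumes "closed_subspace smul M"
  shows "self_adjoint ip (orth_proj ip M)"
  unfolding self_adjoint_def
proof (intro allI)
  fix x y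
  let ?P = "orth_proj ip M"
  note P = orth_proj_in [OF assms] orth_proj_diff [OF assms]
  have "ip (?P x) (y - ?P y) = 0" "ip (x - ?P x) (?P y) = 0"
    using ip_orth_compl P by blast+
  then show "ip (?P x) y = ip x (?P y)"
    by (simp add: ip_diff_left ip_diff_right)
qed

lemma self_adjoint_diff:
  assumes "self_adjoint ip A" "self_adjoint ip B"
  shows "self_adjoint ip (\<lambda>x. A x - B x)"
  using assms by (simp add: self_adjoint_def ip_diff_left ip_diff_right)

text \<open>Moving one factor across the inner product turns the quadratic form of
  \<open>A \<circ> A\<close> at \<open>x\<close> into the squared norm of \<open>A x\<close>, and
  likewise for \<open>B\<close>.\<close>

lemma op_ge_square:
  assumes A: "A \<in> bounded_ops smul" "self_adjoint ip A"
    and B: "B \<in> bounded_ops smul" "self_adjoint ip B"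
    and le: "\<And>x. norm (B x) \<le> norm (A x)"
  shows "op_ge smul ip (A ^^ 2) (B ^^ 2)"
proof -
  have sq: "(F ^^ 2) = F \<circ> F" for F :: "'h \<Rightarrow> 'h"
    by (simp add: numeral_2_eq_2)
  have "ip (A (A x) - B (B x)) x = of_real ((norm (A x))\<^sup>2 - (norm (B x))\<^sup>2)" for x
    using A(2) B(2) by (simp add: self_adjoint_def ip_diff_left ip_self)
  moreover have "(norm (B x))\<^sup>2 \<le> (norm (A x))\<^sup>2" for x
    using le by (simp add: power_mono)
  ultimately have "ip (A (A x) - B (B x)) x \<in> \<real>\<^sub>\<ge>\<^sub>0" for x
    unfolding nonneg_Reals_def by (auto intro!: imageI simp del: of_real_diff)
  then show ?thesis
    using A B by (simp add: op_ge_def sq bounded_ops_comp self_adjoint_def)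
qed

section \<open>The norm inequality\<close>

lemma norm_diff_orth_proj_ge:
  assumes T: "T \<in> bounded_ops smul"
    and M: "closed_subspace smul M" and N: "closed_subspace smul N"
    and T_eq: "T = orth_proj ip M \<circ> orth_proj ip N"
  shows "norm (orth_proj ip (closure (range T)) x - orth_proj ip (orth_compl ip (null_space T)) x)
    \<le> norm (orth_proj ip M x - orth_proj ip N x)"
proof -
  let ?P = "orth_proj ip M" and ?Q = "orth_proj ip N"
  define M0 where "M0 = closure (range T)"
  define K where "K = null_space T"
  define m0 where "m0 = orth_proj ip M0 x"
  define n0 where "n0 = orth_proj ip (orth_compl ip K) x"
  define u where "u = ?P x - m0"
  define v where "v = ?Q x - n0"
  have sub: "subspace M" "subspace N" and cloM: "closed M"
    using M N by (auto simp: closed_subspace_def)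
  have M0: "closed_subspace smul M0"
    unfolding M0_def by (rule closed_subspace_closure_range [OF T])
  have K: "closed_subspace smul K"
    unfolding K_def by (rule closed_subspace_null_space [OF T])
  have subK: "subspace K"
    using K by (simp add: closed_subspace_def)
  have n0_eq: "n0 = x - orth_proj ip K x"
    unfolding n0_def by (rule orth_proj_orth_compl [OF K])
  have n0K: "n0 \<in> orth_compl ip K"
    unfolding n0_eq by (rule orth_proj_diff [OF K])
  have Q_id: "?Q y = y" if "y \<in> N" for y
    using that by (intro orth_proj_eqI sub) (auto simp: orth_compl_def)
  have Q_zero: "?Q y = 0" if "y \<in> orth_compl ip N" for y
    using that subspace_0 [OF sub(2)] by (intro orth_proj_eqI sub) auto
  \<comment> \<open>This inclusion of the complement of \<open>N\<close> in the null space is what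
    later yields both \<open>n0N\<close> and \<open>vK\<close>.\<close>
  have perpK: "y \<in> K" if "y \<in> orth_compl ip N" for y
    using Q_zero [OF that] bounded_ops_zero [OF orth_proj_bounded_ops [OF M]]
    by (simp add: K_def null_space_def T_eq)

  have "range T \<subseteq> M"
    using orth_proj_in [OF M] by (auto simp: T_eq)
  then have "M0 \<subseteq> M"
    unfolding M0_def using cloM by (rule closure_minimal)
  then have m0M: "m0 \<in> M" and m0M0: "m0 \<in> M0"
    using orth_proj_in [OF M0] by (auto simp: m0_def)
  have uM: "u \<in> M"
    unfolding u_def using orth_proj_in [OF M] m0M subspace_diff [OF sub(1)] by blast
  \<comment> \<open>\<open>u\<close> is the difference of the remainders \<open>x - m0\<close> and
    \<open>x - ?P x\<close>, both orthogonal to \<open>M0\<close> because \<open>M0\<close> lies in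
    \<open>M\<close>.\<close>
  have uM0: "ip y u = 0" if "y \<in> M0" for y
  proof -
    have "ip (x - ?P x) y = 0" "ip (x - m0) y = 0"
      using ip_orth_compl(1) orth_proj_diff [OF M] orth_proj_diff [OF M0] that \<open>M0 \<subseteq> M\<close>
      unfolding m0_def by blast+
    then have "ip u y = 0"
      by (simp add: u_def ip_diff_left)
    then show ?thesis
      using ip_eq_zero_commute by blast
  qed
  \<comment> \<open>Split \<open>y\<close> as \<open>?P y\<close> plus a remainder: the first equals
    \<open>T y\<close> and lies in \<open>M0\<close>, the second is orthogonal to \<open>M\<close>,
    which contains \<open>u\<close>.\<close>
  have uN: "ip y u = 0" if "y \<in> N" for y
  proof -
    have "T y \<in> M0"
      unfolding M0_def using closure_subset [of "range T"] by blast
    then have "ip (?P y) u = 0"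
      using uM0 Q_id [OF that] by (simp add: T_eq)
    moreover have "ip (y - ?P y) u = 0"
      using ip_orth_compl(1) [OF orth_proj_diff [OF M] uM] .
    ultimately show ?thesis
      by (simp add: ip_diff_left)
  qed

  \<comment> \<open>The remainder \<open>n0 - ?Q n0\<close> lies in \<open>K\<close>, so it is
    orthogonal to \<open>n0\<close>; it is also orthogonal to \<open>?Q n0\<close>, hence to
    itself.\<close>
  have n0N: "n0 \<in> N"
  proof -
    have r: "n0 - ?Q n0 \<in> orth_compl ip N"
      by (rule orth_proj_diff [OF N])
    have "ip n0 (n0 - ?Q n0) = 0"
      using ip_orth_compl(1) [OF n0K perpK [OF r]] .
    moreover have "ip (?Q n0) (n0 - ?Q n0) = 0"
      using ip_orth_compl(2) [OF r orth_proj_in [OF N]] .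
    ultimately have "ip (n0 - ?Q n0) (n0 - ?Q n0) = 0"
      by (simp add: ip_diff_left)
    then have "n0 = ?Q n0"
      by simp
    then show ?thesis
      using orth_proj_in [OF N] by metis
  qed
  have vN: "v \<in> N"
    unfolding v_def using orth_proj_in [OF N] n0N subspace_diff [OF sub(2)] by blast
  \<comment> \<open>This difference is \<open>v\<close>, rewritten through \<open>n0_eq\<close> so
    that both terms visibly lie in \<open>K\<close>.\<close>
  have "orth_proj ip K x - (x - ?Q x) \<in> K"
    using orth_proj_in [OF K] perpK [OF orth_proj_diff [OF N]] subspace_diff [OF subK] by blast
  then have vK: "v \<in> K"
    by (simp add: v_def n0_eq algebra_simps)
  \<comment> \<open>On \<open>N\<close> the operator \<open>T\<close> acts as \<open>?P\<close>, so
    \<open>v\<close> being in its null space means that \<open>v\<close> is orthogonal to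
    \<open>M\<close>.\<close>
  then have "?P v = 0"
    using Q_id [OF vN] by (simp add: K_def null_space_def T_eq)
  then have vM: "v \<in> orth_compl ip M"
    using orth_proj_diff [OF M, of v] by simp

  \<comment> \<open>All four products vanish separately: \<open>uM0\<close> and \<open>uN\<close>
    handle \<open>u\<close>, while \<open>vM\<close> and \<open>n0K\<close> handle
    \<open>v\<close>.\<close>
  have "ip (m0 - n0) (u - v) = 0"
    using uM0 [OF m0M0] uN [OF n0N] ip_orth_compl(2) [OF vM m0M] ip_orth_compl(1) [OF n0K vK]
    by (simp add: ip_diff_left ip_diff_right)
  then have "(norm ((m0 - n0) + (u - v)))\<^sup>2 = (norm (m0 - n0))\<^sup>2 + (norm (u - v))\<^sup>2"
    by (rule norm_add_pythagoras)
  moreover have "(m0 - n0) + (u - v) = ?P x - ?Q x"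
    by (simp add: u_def v_def)
  ultimately have "(norm (m0 - n0))\<^sup>2 \<le> (norm (?P x - ?Q x))\<^sup>2"
    by simp
  then show ?thesis
    unfolding m0_def n0_def M0_def K_def by (rule power2_le_imp_le) simp
qed

text \<open>The projection onto the complement is the identity minus \<open>orth_proj ip S\<close>,
  and both properties pass to differences.\<close>

lemma
  assumes "closed_subspace smul S"
  shows orth_proj_orth_compl_bounded_ops: "orth_proj ip (orth_compl ip S) \<in> bounded_ops smul"
    and orth_proj_orth_compl_self_adjoint: "self_adjoint ip (orth_proj ip (orth_compl ip S))"
proof -
  have eq: "orth_proj ip (orth_compl ip S) = (\<lambda>x. x - orth_proj ip S x)"
    by (rule ext) (rule orth_proj_orth_compl [OF assms])
  have "(\<lambda>x. x) \<in> bounded_ops smul"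
    by (rule bounded_opsI [of _ 1]) auto
  then show "orth_proj ip (orth_compl ip S) \<in> bounded_ops smul"
    unfolding eq by (rule bounded_ops_diff [OF _ orth_proj_bounded_ops [OF assms]])
  have "self_adjoint ip (\<lambda>x. x)"
    by (simp add: self_adjoint_def)
  then show "self_adjoint ip (orth_proj ip (orth_compl ip S))"
    unfolding eq by (rule self_adjoint_diff [OF _ orth_proj_self_adjoint [OF assms]])
qed

end

theorem corollary3p9:
  fixes smul :: "'k::real_or_complex \<Rightarrow> 'h::banach \<Rightarrow> 'h"
    and ip :: "'h \<Rightarrow> 'h \<Rightarrow> 'k"
    and T :: "'h \<Rightarrow> 'h"
    and M N :: "'h set"
  assumes "hilbert_space smul ip"
    and "T \<in> bounded_ops smul"
    and "closed_subspace smul M"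
    and "closed_subspace smul N"
    and "T = orth_proj ip M \<circ> orth_proj ip N"
  shows "(\<forall>x. norm (orth_proj ip M x - orth_proj ip N x)
            \<ge> norm (orth_proj ip (closure (range T)) x
                    - orth_proj ip (orth_compl ip (null_space T)) x))
       \<and> op_ge smul ip
           ((\<lambda>x. orth_proj ip M x - orth_proj ip N x) ^^ 2)
           ((\<lambda>x. orth_proj ip (closure (range T)) x
                  - orth_proj ip (orth_compl ip (null_space T)) x) ^^ 2)"
proof -
  interpret hilbert_space smul ip
    by fact
  note R = closed_subspace_closure_range [OF assms(2)]
  note K = closed_subspace_null_space [OF assms(2)]
  let ?A = "\<lambda>x. orth_proj ip M x - orth_proj ip N x"
  let ?B = "\<lambda>x. orth_proj ip (closure (range T)) x - orth_proj ip (orth_compl ip (null_space T)) x"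
  \<comment> \<open>This pointwise estimate is the first conjunct and also the hypothesis that
    \<open>op_ge_square\<close> turns into the second.\<close>
  note le = norm_diff_orth_proj_ge [OF assms(2-5)]
  have "?A \<in> bounded_ops smul" "self_adjoint ip ?A"
    using assms(3,4)
    by (simp_all add: bounded_ops_diff self_adjoint_diff orth_proj_bounded_ops orth_proj_self_adjoint)
  moreover have "?B \<in> bounded_ops smul" "self_adjoint ip ?B"
    by (rule bounded_ops_diff self_adjoint_diff
        orth_proj_bounded_ops [OF R] orth_proj_self_adjoint [OF R]
        orth_proj_orth_compl_bounded_ops [OF K] orth_proj_orth_compl_self_adjoint [OF K])+
  ultimately have "op_ge smul ip (?A ^^ 2) (?B ^^ 2)"
    using le by (rule op_ge_square)
  then show ?thesis
    using le by blast
qed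

end
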